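(* If $\Omega\subset\mathbb{C}^d$ is a $\mathbb{C}$-properly convex domain, $z_0\in\Omega$, $\xi\in\partial\Omega$, $H$ is a supporting complex hyperplane of $\Omega$ at $\xi$, $q\in(\xi,z_0]$, and $$r:=\frac{\delta_\Omega(z_0)}{\|\xi-z_0\|},$$ then there exists an affine map $A$ with the following properties: (1) $A\Omega\in\mathbb{K}_d(r)$; (2) $A(q)=0$; (3) $A(\xi)=e_1$; (4) $A(H)=e_1+\mathrm{Span}_{\mathbb{C}}\{e_2,\dots,e_d\}$; and (5) if $\delta_H=\max\{\delta_\Omega(q;v): v\in-\xi+H \text{ non-zero}\}$, then $$\|A(z_1)-A(z_2)\|\ge\frac{r}{\sqrt2\,\delta_H}\|z_1-z_2\|\quad\text{for all } z_1,z_2\in\mathbb{C}^d.$$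
   Context: A convex domain in $\mathbb{C}^d$ is $\mathbb{C}$-properly convex if it contains no entire complex affine line. "Affine map" means a complex affine automorphism of $\mathbb{C}^d$. $\|\cdot\|$ is the Euclidean norm and $e_1,\dots,e_d$ the standard basis of $\mathbb{C}^d$; $\mathbb{D}\subset\mathbb{C}$ is the open unit disk. $(\xi,z_0]$ is the real segment from $\xi$ (excluded) to $z_0$ (included). A supporting complex hyperplane of $\Omega$ at $\xi$ is a complex affine hyperplane $H$ with $\xi\in H$ and $H\cap\Omega=\emptyset$; $-\xi+H$ is the complex hyperplane through $0$ parallel to $H$. For $z\in\Omega$ and $v\in\mathbb{C}^d\setminus\{0\}$: $\delta_\Omega(z)=\inf\{\|z-w\|:w\in\partial\Omega\}$ and $\delta_\Omega(z;v)=\inf\{\|z-w\|:w\in\partial\Omega\cap(z+\mathbb{C}\cdot v)\}$. For $r\in(0,1]$, $\mathbb{K}_d(r)$ is the set of $\mathbb{C}$-properly convex domains $\Omega\subset\mathbb{C}^d$ such that (i) $r\mathbb{D}\cdot e_1\subset\Omega$ and $\mathbb{D}\cdot e_j\subset\Omega$ for $j=2,\dots,d$; and (ii) for every $j=1,\dots,d$, $e_j\in\partial\Omega$ and $(e_j+\mathrm{Span}_{\mathbb{C}}\{e_{j+1},\dots,e_d\})\cap\Omega=\emptyset$. *)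

theory Defs
  imports "HOL-Analysis.Analysis"
begin

text \<open>
  Throughout, \<open>\<complex>\<^sup>d\<close> is \<^typ>\<open>complex ^ 'd\<close> over a finite linearly ordered index type, so that
  \<open>e\<^sub>1\<close> is the basis vector of the least index and \<open>e\<^sub>j\<^sub>+\<^sub>1, \<dots>, e\<^sub>d\<close> are those of the indices above \<open>j\<close>.
  Complex spans, subspaces and dimensions are the ones of the interpretation \<open>vec\<close>
  (scalar multiplication \<open>*s\<close>), not the real ones.
\<close>

definition std_basis :: "'d \<Rightarrow> complex ^ 'd::finite"
  where "std_basis j = axis j 1"

definition first_index :: "'d::{finite,linorder}"
  where "first_index = Min UNIV"

definition C_properly_convex_domain :: "(complex ^ 'd::finite) set \<Rightarrow> bool"
  where "C_properly_convex_domain \<Omega> \<longleftrightarrow>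
    open \<Omega> \<and> connected \<Omega> \<and> \<Omega> \<noteq> {} \<and> convex \<Omega> \<and>
    \<not> (\<exists>z v. v \<noteq> 0 \<and> range (\<lambda>c. z + c *s v) \<subseteq> \<Omega>)"

definition affine_automorphism :: "(complex ^ 'd::finite \<Rightarrow> complex ^ 'd) \<Rightarrow> bool"
  where "affine_automorphism A \<longleftrightarrow>
    (\<exists>L b. Vector_Spaces.linear (*s) (*s) L \<and> bij L \<and> A = (\<lambda>z. L z + b))"

definition complex_hyperplane :: "(complex ^ 'd::finite) set \<Rightarrow> bool"
  where "complex_hyperplane H \<longleftrightarrow>
    (\<exists>p V. vec.subspace V \<and> vec.dim V + 1 = CARD('d) \<and> H = (+) p ` V)"

definition supporting_complex_hyperplane ::
    "(complex ^ 'd::finite) set \<Rightarrow> complex ^ 'd \<Rightarrow> (complex ^ 'd) set \<Rightarrow> bool"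
  where "supporting_complex_hyperplane \<Omega> \<xi> H \<longleftrightarrow>
    complex_hyperplane H \<and> \<xi> \<in> H \<and> H \<inter> \<Omega> = {}"

text \<open>
  \<^const>\<open>infdist\<close> is the infimum of the distances to a nonempty set.  Both sets below are nonempty
  when \<open>\<Omega>\<close> is a \<open>\<complex>\<close>-properly convex domain, \<open>z \<in> \<Omega>\<close> and \<open>v \<noteq> 0\<close>.
\<close>

definition bdry_dist :: "(complex ^ 'd::finite) set \<Rightarrow> complex ^ 'd \<Rightarrow> real"
  where "bdry_dist \<Omega> z = infdist z (frontier \<Omega>)"

definition bdry_dist_dir ::
    "(complex ^ 'd::finite) set \<Rightarrow> complex ^ 'd \<Rightarrow> complex ^ 'd \<Rightarrow> real"
  where "bdry_dist_dir \<Omega> z v = infdist z (frontier \<Omega> \<inter> range (\<lambda>c. z + c *s v))"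

text \<open>The class is only meant for \<open>r \<in> (0, 1]\<close>; for other \<open>r\<close> it is empty here.\<close>

definition K_class :: "real \<Rightarrow> (complex ^ 'd::{finite,linorder}) set set"
  where "K_class r = {\<Omega>. 0 < r \<and> r \<le> 1 \<and> C_properly_convex_domain \<Omega> \<and>
    (\<lambda>c. c *s std_basis first_index) ` ball 0 r \<subseteq> \<Omega> \<and>
    (\<forall>j. j \<noteq> first_index \<longrightarrow> (\<lambda>c. c *s std_basis j) ` ball 0 1 \<subseteq> \<Omega>) \<and>
    (\<forall>j. std_basis j \<in> frontier \<Omega> \<and>
         (+) (std_basis j) ` vec.span {std_basis k | k. j < k} \<inter> \<Omega> = {})}"

definition is_maximum :: "real set \<Rightarrow> real \<Rightarrow> bool"
  where "is_maximum S m \<longleftrightarrow> m \<in> S \<and> (\<forall>x\<in>S. x \<le> m)"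

end

theory Submission imports Defs begin

text \<open>
  Let \<open>V = H - \<xi>\<close>. Choose \<open>\<xi>\<^sub>2\<close> as a boundary point closest to \<open>q\<close> in \<open>q + V\<close>, then \<open>\<xi>\<^sub>3\<close> closest to \<open>q\<close> in
  \<open>q +\<close> the Hermitian complement of \<open>\<xi>\<^sub>2 - q\<close> in \<open>V\<close>, and so on. At a closest point, \<open>\<Omega>\<close> contains a ball
  of its slice touching the boundary there, so the plane tangent to that ball misses \<open>\<Omega>\<close>. The map \<open>A\<close>
  sends \<open>q\<close> to \<open>0\<close>, \<open>\<xi>\<close> to \<open>e\<^sub>1\<close> and \<open>\<xi>\<^sub>j\<close> to \<open>e\<^sub>j\<close>. By convexity \<open>\<Omega>\<close> contains the ball of radius
  \<open>r \<parallel>\<xi> - q\<parallel>\<close> around \<open>q\<close>, whence \<open>r \<parallel>\<xi> - q\<parallel> \<le> \<delta>\<^sub>H\<close>. The vectors \<open>\<xi>\<^sub>j - q\<close>, \<open>j \<ge> 2\<close>, are orthogonal of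
  norm at most \<open>\<delta>\<^sub>H\<close>, so \<open>A\<^sup>-\<^sup>1\<close> has Lipschitz constant at most \<open>\<surd>2 \<delta>\<^sub>H / r\<close>.
\<close>

section \<open>Complex scalars and the Hermitian form on \<open>complex ^ 'n\<close>\<close>

lemma norm_vector_scalar_mult: "norm (c *s x) = cmod c * norm (x :: complex ^ 'n::finite)"
  by (simp add: norm_vec_def L2_set_right_distrib norm_mult)

lemma scaleR_eq_vector_scalar_mult: "t *\<^sub>R x = complex_of_real t *s (x :: complex ^ 'n::finite)"
  by (simp add: vec_eq_iff) (simp add: scaleR_conv_of_real)

text \<open>The library inner product on \<open>complex ^ 'n\<close> is real-valued, and its
  orthogonal complements need not be complex subspaces. This form is linear in the first argument,
  so its complements are complex, and its real part is the real inner product.\<close>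

definition hermitian :: "complex ^ 'n::finite \<Rightarrow> complex ^ 'n \<Rightarrow> complex"
  where "hermitian x y = (\<Sum>i\<in>UNIV. x $ i * cnj (y $ i))"

lemma hermitian_add_left: "hermitian (x + y) z = hermitian x z + hermitian y z"
  by (simp add: hermitian_def sum.distrib algebra_simps)

lemma hermitian_diff_left: "hermitian (x - y) z = hermitian x z - hermitian y z"
  by (simp add: hermitian_def sum_subtractf algebra_simps)

lemma hermitian_scale_left: "hermitian (c *s x) z = c * hermitian x z"
  by (simp add: hermitian_def sum_distrib_left algebra_simps)

lemma hermitian_scale_right: "hermitian x (c *s z) = cnj c * hermitian x z"
  by (simp add: hermitian_def sum_distrib_left algebra_simps)

lemma hermitian_commute: "hermitian x y = cnj (hermitian y x)"
  by (simp add: hermitian_def algebra_simps)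

lemma inner_eq_Re_hermitian: "x \<bullet> y = Re (hermitian x y)"
  by (simp add: hermitian_def inner_vec_def inner_complex_def)

lemma hermitian_self: "hermitian x x = complex_of_real ((norm x)\<^sup>2)"
proof -
  have "Im (hermitian x x) = 0"
    by (simp add: hermitian_def)
  then show ?thesis
    by (simp add: complex_eq_iff power2_norm_eq_inner inner_eq_Re_hermitian)
qed

lemma subspace_hermitian_complement:
  assumes "vec.subspace V"
  shows "vec.subspace {w \<in> V. hermitian w u = 0}"
  using assms
  by (auto simp: vec.subspace_def hermitian_add_left hermitian_scale_left hermitian_def[of 0])

text \<open>Subtracting from \<open>w\<close> its projection to the complex line of \<open>u\<close>
  lands in the complement, so the complement and \<open>u\<close> together span
  \<open>V\<close>.\<close>

lemma dim_hermitian_complement: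
  assumes V: "vec.subspace V" and u: "u \<in> V" "u \<noteq> 0"
  shows "vec.dim V \<le> Suc (vec.dim {w \<in> V. hermitian w u = 0})"
proof -
  let ?W = "{w \<in> V. hermitian w u = 0}"
  have "w \<in> vec.span (insert u ?W)" if "w \<in> V" for w
  proof -
    define c where "c = hermitian w u / hermitian u u"
    have "hermitian u u \<noteq> 0"
      using u by (simp add: hermitian_self)
    then have "w - c *s u \<in> ?W"
      using V u that
      by (simp add: hermitian_diff_left hermitian_scale_left c_def vec.subspace_diff vec.subspace_scale)
    then have "(w - c *s u) + c *s u \<in> vec.span (insert u ?W)"
      by (intro vec.span_add vec.span_scale vec.span_base) auto
    then show ?thesis by simp
  qed
  then have "vec.dim V \<le> vec.dim (insert u ?W)"
    by (intro vec.dim_mono) auto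
  also have "\<dots> \<le> Suc (vec.dim ?W)"
    by (simp add: vec.dim_insert)
  finally show ?thesis .
qed

lemma vec_subspace_imp_subspace:
  "vec.subspace V \<Longrightarrow> subspace (V :: (complex ^ 'n::finite) set)"
  by (simp add: vec.subspace_def subspace_def scaleR_eq_vector_scalar_mult)

section \<open>Segments, frontier points and distances along complex lines\<close>

lemma open_convex_segment_mem:
  fixes \<Omega> :: "'a::euclidean_space set"
  assumes "convex \<Omega>" "open \<Omega>" "q \<in> \<Omega>" "x \<in> closure \<Omega>" "0 \<le> t" "t < 1"
  shows "q + t *\<^sub>R (x - q) \<in> \<Omega>"
proof -
  have "x - (1 - t) *\<^sub>R (x - q) \<in> interior \<Omega>"
    using assms by (intro mem_interior_closure_convex_shrink) (auto simp: interior_open)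
  then show ?thesis
    using assms by (simp add: interior_open algebra_simps)
qed

lemma frontier_meets_segment:
  fixes q x :: "'a::real_normed_vector"
  assumes "q \<in> \<Omega>" "x \<notin> \<Omega>"
  obtains t where "0 \<le> t" "t \<le> 1" "q + t *\<^sub>R (x - q) \<in> frontier \<Omega>"
proof -
  have "closed_segment q x \<inter> frontier \<Omega> \<noteq> {}"
    using assms by (intro connected_Int_frontier) auto
  then obtain y where "y \<in> closed_segment q x" "y \<in> frontier \<Omega>" by blast
  then obtain t where "0 \<le> t" "t \<le> 1" "y = (1 - t) *\<^sub>R q + t *\<^sub>R x"
    by (auto simp: in_segment)
  moreover have "(1 - t) *\<^sub>R q + t *\<^sub>R x = q + t *\<^sub>R (x - q)"
    by (simp add: algebra_simps)
  ultimately show thesis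
    using that[of t] \<open>y \<in> frontier \<Omega>\<close> by simp
qed

text \<open>Proper convexity gives a point of the line outside \<Omega>; the segment from
  \<open>q\<close> to it stays in the line and crosses the frontier.\<close>

lemma frontier_meets_complex_line:
  assumes "C_properly_convex_domain \<Omega>" "q \<in> \<Omega>" "v \<noteq> 0"
  shows "frontier \<Omega> \<inter> range (\<lambda>c. q + c *s v) \<noteq> {}"
proof -
  obtain c where c: "q + c *s v \<notin> \<Omega>"
    using assms by (auto simp: C_properly_convex_domain_def image_subset_iff)
  obtain t where "q + t *\<^sub>R ((q + c *s v) - q) \<in> frontier \<Omega>"
    using frontier_meets_segment[OF assms(2) c] by blast
  then have "q + (complex_of_real t * c) *s v \<in> frontier \<Omega>"
    by (simp add: scaleR_eq_vector_scalar_mult vector_smult_assoc)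
  then show ?thesis by blast
qed

text \<open>Frontier points lie outside the open set \<Omega>, so none on the line is closer than
  \<rho>. Together with \<open>mem_of_lt_bdry_dist_dir\<close> this identifies
  \<open>bdry_dist_dir\<close> as the radius of the largest open disc about \<open>q\<close> in the
  complex line that lies in \<Omega>.\<close>

lemma bdry_dist_dir_ge:
  assumes "C_properly_convex_domain \<Omega>" "q \<in> \<Omega>" "v \<noteq> 0"
    and "\<And>c. cmod c * norm v < \<rho> \<Longrightarrow> q + c *s v \<in> \<Omega>"
  shows "\<rho> \<le> bdry_dist_dir \<Omega> q v"
proof -
  let ?F = "frontier \<Omega> \<inter> range (\<lambda>c. q + c *s v)"
  \<comment> \<open>\<open>infdist\<close> to the empty set is 0 by convention, so a lower bound
    requires a frontier point on the line.\<close>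
  have ne: "?F \<noteq> {}"
    using frontier_meets_complex_line[OF assms(1-3)] .
  have "\<rho> \<le> dist q y" if "y \<in> ?F" for y
  proof -
    from that obtain c where c: "y = q + c *s v" by blast
    have "y \<notin> \<Omega>"
      using that assms(1) by (simp add: C_properly_convex_domain_def frontier_def interior_open)
    then have "\<not> cmod c * norm v < \<rho>" using assms(4) c by blast
    then show ?thesis by (simp add: c dist_norm norm_vector_scalar_mult)
  qed
  then show ?thesis
    using ne unfolding bdry_dist_dir_def infdist_def by (auto intro!: cINF_greatest)
qed

text \<open>If the point were missing, the segment from \<open>q\<close> to it would contain a
  frontier point of the same complex line at no greater distance.\<close>

lemma mem_of_lt_bdry_dist_dir:
  assumes "q \<in> \<Omega>" "cmod c * norm v < bdry_dist_dir \<Omega> q v"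
  shows "q + c *s v \<in> \<Omega>"
proof (rule ccontr)
  assume c: "q + c *s v \<notin> \<Omega>"
  obtain t where t: "0 \<le> t" "t \<le> 1" "q + t *\<^sub>R ((q + c *s v) - q) \<in> frontier \<Omega>"
    using frontier_meets_segment[OF assms(1) c] by blast
  let ?y = "q + (complex_of_real t * c) *s v"
  have "?y \<in> frontier \<Omega>"
    using t by (simp add: scaleR_eq_vector_scalar_mult vector_smult_assoc)
  then have "bdry_dist_dir \<Omega> q v \<le> dist q ?y"
    unfolding bdry_dist_dir_def by (intro infdist_le) auto
  also have "\<dots> = t * (cmod c * norm v)"
    using t by (simp add: dist_norm norm_vector_scalar_mult norm_mult)
  also have "\<dots> \<le> cmod c * norm v"
    using t by (intro mult_left_le_one_le) auto
  finally show False using assms(2) by simp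
qed

lemma bdry_dist_dir_scale:
  assumes "a \<noteq> 0"
  shows "bdry_dist_dir \<Omega> q (a *s v) = bdry_dist_dir \<Omega> q v"
proof -
  have "range (\<lambda>c. q + c *s (a *s v)) = range (\<lambda>c. q + c *s v)"
  proof (intro equalityI subsetI)
    fix y assume "y \<in> range (\<lambda>c. q + c *s v)"
    then obtain c where "y = q + c *s v" by blast
    then have "y = q + (c / a) *s (a *s v)"
      using assms by (simp add: vector_smult_assoc)
    then show "y \<in> range (\<lambda>c. q + c *s (a *s v))" by blast
  qed (auto simp: vector_smult_assoc)
  then show ?thesis by (simp add: bdry_dist_dir_def)
qed

text \<open>This is upper semicontinuity of the directional distance. The value is at least \<rho>
  exactly when the disc of radius \<rho> lies in the closure of \<Omega>, and for each fixed
  \<open>c\<close> that is a closed condition on \<open>v\<close>.\<close>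

lemma closed_bdry_dist_dir_superlevel:
  assumes \<Omega>: "C_properly_convex_domain \<Omega>" "q \<in> \<Omega>"
  shows "closed {v \<in> sphere 0 1. \<rho> \<le> bdry_dist_dir \<Omega> q v}"
proof -
  have conv: "convex \<Omega>" "open \<Omega>"
    using \<Omega> by (auto simp: C_properly_convex_domain_def)
  have "{v \<in> sphere 0 1. \<rho> \<le> bdry_dist_dir \<Omega> q v} =
      sphere 0 1 \<inter> (\<Inter>c \<in> ball 0 \<rho>. {v. q + c *s v \<in> closure \<Omega>})"
  proof (intro equalityI subsetI)
    fix v :: "complex ^ 'a" assume "v \<in> {v \<in> sphere 0 1. \<rho> \<le> bdry_dist_dir \<Omega> q v}"
    then have v: "norm v = 1" "\<rho> \<le> bdry_dist_dir \<Omega> q v" by auto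
    have "q + c *s v \<in> closure \<Omega>" if "c \<in> ball 0 \<rho>" for c
    proof -
      have "q + c *s v \<in> \<Omega>"
        using that v by (intro mem_of_lt_bdry_dist_dir \<Omega>(2)) auto
      then show ?thesis using closure_subset by blast
    qed
    then show "v \<in> sphere 0 1 \<inter> (\<Inter>c \<in> ball 0 \<rho>. {v. q + c *s v \<in> closure \<Omega>})"
      using v by simp
  next
    fix v :: "complex ^ 'a"
    assume v: "v \<in> sphere 0 1 \<inter> (\<Inter>c \<in> ball 0 \<rho>. {v. q + c *s v \<in> closure \<Omega>})"
    have "q + c *s v \<in> \<Omega>" if "cmod c * norm v < \<rho>" for c
    proof (cases "c = 0")
      case False
      have "cmod c < \<rho>" using v that by simp
      \<comment> \<open>The hypothesis gives only points of the closure. Going out to the slightly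
        larger radius \<open>s\<close> and shrinking back towards \<open>q\<close> gives a point of
        \<Omega> itself.\<close>
      then obtain s where s: "cmod c < s" "s < \<rho>" using dense by blast
      let ?c = "complex_of_real (s / cmod c) * c"
      have "0 < s" using s by (meson le_less_trans norm_ge_zero)
      then have "cmod ?c = s" using False by (simp add: norm_mult norm_divide)
      then have "q + ?c *s v \<in> closure \<Omega>" using v s by auto
      then have "q + (cmod c / s) *\<^sub>R ((q + ?c *s v) - q) \<in> \<Omega>"
        using conv \<Omega>(2) s \<open>0 < s\<close> by (intro open_convex_segment_mem) auto
      moreover have "complex_of_real (cmod c / s) * ?c = c"
        using False \<open>0 < s\<close> by simp
      ultimately show ?thesis
        by (simp add: scaleR_eq_vector_scalar_mult vector_smult_assoc)
    qed (use \<Omega> in simp)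
    then have "\<rho> \<le> bdry_dist_dir \<Omega> q v"
      using v \<Omega> by (intro bdry_dist_dir_ge) auto
    then show "v \<in> {v \<in> sphere 0 1. \<rho> \<le> bdry_dist_dir \<Omega> q v}" using v by simp
  qed
  moreover have "closed {v. q + c *s v \<in> closure \<Omega>}" for c
  proof -
    have "continuous_on UNIV (\<lambda>v. q + c *s v)"
      by (auto simp: vector_scalar_mult_def intro!: continuous_intros)
    then show ?thesis
      using closed_vimage[of "closure \<Omega>" "\<lambda>v. q + c *s v"]
      by (simp add: vimage_def)
  qed
  ultimately show ?thesis
    by (auto intro!: closed_Int closed_INT)
qed

text \<open>The distance depends only on the complex line of \<open>v\<close>, so unit vectors
  suffice. The superlevel sets for the values in \<open>S\<close> are closed in the compact unit
  sphere of \<open>V\<close>; by the finite intersection property they share a vector, and it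
  realises the maximum.\<close>

lemma bdry_dist_dir_attains_max:
  assumes \<Omega>: "C_properly_convex_domain \<Omega>" "q \<in> \<Omega>" and V: "vec.subspace V"
    and S: "S = {bdry_dist_dir \<Omega> q v | v. v \<in> V \<and> v \<noteq> 0}" "S \<noteq> {}"
  shows "\<exists>m. is_maximum S m"
proof -
  let ?K = "sphere 0 1 \<inter> V"
  let ?F = "\<lambda>\<rho>. {v \<in> sphere 0 1. \<rho> \<le> bdry_dist_dir \<Omega> q v}"
  have unit: "\<exists>v \<in> ?K. \<rho> = bdry_dist_dir \<Omega> q v" if "\<rho> \<in> S" for \<rho>
  proof -
    from that S(1) obtain v where v: "\<rho> = bdry_dist_dir \<Omega> q v" "v \<in> V" "v \<noteq> 0"
      by blast
    let ?v = "complex_of_real (1 / norm v) *s v"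
    have "?v \<in> ?K"
      using v V by (simp add: norm_vector_scalar_mult vec.subspace_scale norm_divide)
    moreover have "\<rho> = bdry_dist_dir \<Omega> q ?v"
      using v by (subst bdry_dist_dir_scale) auto
    ultimately show ?thesis by blast
  qed
  have "compact ?K"
    using V by (intro compact_Int_closed closed_subspace vec_subspace_imp_subspace) auto
  then have "?K \<inter> (\<Inter>\<rho>\<in>S. ?F \<rho>) \<noteq> {}"
  proof (rule compact_imp_fip_image)
    fix I assume I: "finite I" "I \<subseteq> S"
    show "?K \<inter> (\<Inter>\<rho>\<in>I. ?F \<rho>) \<noteq> {}"
    proof (cases "I = {}")
      case True
      then show ?thesis using S(2) unit by auto
    next
      case False
      \<comment> \<open>A vector realising the largest value in \<open>I\<close> lies in all the
        superlevel sets of \<open>I\<close> at once.\<close>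
      then have "Max I \<in> S" using I Max_in by blast
      then obtain v where "v \<in> ?K" "Max I = bdry_dist_dir \<Omega> q v" using unit by blast
      then have "v \<in> ?K \<inter> (\<Inter>\<rho>\<in>I. ?F \<rho>)" using Max_ge[OF I(1)] by auto
      then show ?thesis by blast
    qed
  qed (use closed_bdry_dist_dir_superlevel[OF \<Omega>] in auto)
  then obtain v where v: "v \<in> ?K" "\<And>\<rho>. \<rho> \<in> S \<Longrightarrow> \<rho> \<le> bdry_dist_dir \<Omega> q v"
    by blast
  then have "bdry_dist_dir \<Omega> q v \<in> S" using S(1) by force
  then show ?thesis using v unfolding is_maximum_def by blast
qed

section \<open>Closest frontier points, tangent planes and the orthogonal frame\<close>

lemma closest_frontier_point_in_subspace:
  assumes \<Omega>: "C_properly_convex_domain \<Omega>" "q \<in> \<Omega>"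
    and V: "vec.subspace V" "v \<in> V" "v \<noteq> 0"
  obtains u where "u \<in> V" "u \<noteq> 0" "q + u \<in> frontier \<Omega>"
    "\<And>w. w \<in> V \<Longrightarrow> norm w < norm u \<Longrightarrow> q + w \<in> \<Omega>"
proof -
  let ?C = "frontier \<Omega> \<inter> (+) q ` V"
  have subsp: "subspace V" using V by (simp add: vec_subspace_imp_subspace)
  have "range (\<lambda>c. q + c *s v) \<subseteq> (+) q ` V"
    using V by (auto intro: vec.subspace_scale)
  then have "?C \<noteq> {}"
    using frontier_meets_complex_line[OF \<Omega> V(3)] by blast
  moreover have "closed ?C"
    using subsp by (intro closed_Int closed_translation closed_subspace frontier_closed)
  ultimately obtain y where y: "y \<in> ?C" "\<And>x. x \<in> ?C \<Longrightarrow> dist q y \<le> dist q x"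
    using distance_attains_inf[of ?C q] by blast
  then obtain u where u: "y = q + u" "u \<in> V" by blast
  have "q \<notin> frontier \<Omega>"
    using \<Omega> by (simp add: C_properly_convex_domain_def frontier_def interior_open)
  then have "u \<noteq> 0" using y u by auto
  \<comment> \<open>A missing point would produce a frontier point of the slice \<open>q + V\<close>
    closer to \<open>q\<close> than the minimiser \<open>y\<close>.\<close>
  moreover have "q + w \<in> \<Omega>" if w: "w \<in> V" "norm w < norm u" for w
  proof (rule ccontr)
    assume "q + w \<notin> \<Omega>"
    then obtain t where t: "0 \<le> t" "t \<le> 1" "q + t *\<^sub>R ((q + w) - q) \<in> frontier \<Omega>"
      using frontier_meets_segment[OF \<Omega>(2)] by blast
    then have "q + t *\<^sub>R w \<in> ?C" using w subsp by (auto simp: subspace_scale)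
    from y(2)[OF this] have "norm u \<le> t * norm w" using u t by (simp add: dist_norm)
    also have "\<dots> \<le> norm w" using t by (intro mult_left_le_one_le) auto
    finally show False using w by simp
  qed
  ultimately show thesis using that u y by blast
qed

text \<open>A point of \<open>\<Omega>\<close> on the tangent plane could be pushed slightly outwards inside \<open>\<Omega>\<close>; joining it to a
  suitable point of the ball would then put the contact point \<open>q + u\<close> into \<open>\<Omega>\<close>.\<close>

lemma tangent_plane_disjoint:
  fixes \<Omega> V :: "'a::euclidean_space set"
  assumes \<Omega>: "convex \<Omega>" "open \<Omega>" and V: "subspace V"
    and u: "u \<in> V" "u \<noteq> 0" "q + u \<notin> \<Omega>"
    and ball: "\<And>w. w \<in> V \<Longrightarrow> norm w < norm u \<Longrightarrow> q + w \<in> \<Omega>"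
    and w: "w \<in> V" "w \<bullet> u = 0"
  shows "q + u + w \<notin> \<Omega>"
proof
  assume "q + u + w \<in> \<Omega>"
  then obtain e where e: "0 < e" "ball (q + u + w) e \<subseteq> \<Omega>"
    using \<Omega>(2) open_contains_ball by blast
  \<comment> \<open>The outward push by \<open>\<eta> *\<^sub>R u\<close> has length
    \<open>e / 2\<close>, so it stays in the ball of radius \<open>e\<close>.\<close>
  define \<eta> where "\<eta> = e / (2 * norm u)"
  have \<eta>: "0 < \<eta>" using e u by (simp add: \<eta>_def)
  have "norm (\<eta> *\<^sub>R u) < e" using e u by (simp add: \<eta>_def)
  then have p: "q + u + w + \<eta> *\<^sub>R u \<in> \<Omega>"
    using e by (auto simp: dist_norm intro!: subsetD[OF e(2)])
  \<comment> \<open>By orthogonality \<open>D\<close> is the squared norm of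
    \<open>w + \<eta> *\<^sub>R u\<close>. The value of \<open>s\<close> below minimises the norm of
    \<open>u - s *\<^sub>R (w + \<eta> *\<^sub>R u)\<close>, which makes \<open>x\<close> shorter
    than \<open>u\<close>.\<close>
  define D where "D = \<eta>\<^sup>2 * (norm u)\<^sup>2 + (norm w)\<^sup>2"
  define s where "s = \<eta> * (norm u)\<^sup>2 / D"
  have D: "0 < D" using \<eta> u by (auto simp: D_def intro!: add_pos_nonneg)
  have s: "0 < s" using \<eta> u D by (simp add: s_def)
  define x where "x = u - s *\<^sub>R (w + \<eta> *\<^sub>R u)"
  have "(norm x)\<^sup>2 = (norm u)\<^sup>2 - 2 * s * \<eta> * (norm u)\<^sup>2 + s * (s * D)"
    unfolding power2_norm_eq_inner x_def D_def
    using w by (simp add: inner_diff_left inner_diff_right inner_add_left inner_add_right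
        inner_commute[of u w] algebra_simps power2_eq_square[of \<eta>])
  also have "s * D = \<eta> * (norm u)\<^sup>2" using D by (simp add: s_def)
  also have "(norm u)\<^sup>2 - 2 * s * \<eta> * (norm u)\<^sup>2 + s * (\<eta> * (norm u)\<^sup>2) < (norm u)\<^sup>2"
    using s \<eta> u by (simp add: algebra_simps)
  finally have "norm x < norm u" by (rule power2_less_imp_less) simp
  moreover have "x \<in> V"
    using V u w by (auto simp: x_def intro!: subspace_diff subspace_scale subspace_add)
  ultimately have x: "q + x \<in> \<Omega>" using ball by blast
  \<comment> \<open>With these weights the contact point \<open>q + u\<close> is a convex
    combination of \<open>q + x\<close> and the pushed point.\<close>
  have "(1 / (1 + s)) *\<^sub>R (q + x) + (s / (1 + s)) *\<^sub>R (q + u + w + \<eta> *\<^sub>R u) \<in> \<Omega>"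
    using s by (intro convexD[OF \<Omega>(1) x p]) (auto simp: field_simps)
  also have "(1 / (1 + s)) *\<^sub>R (q + x) + (s / (1 + s)) *\<^sub>R (q + u + w + \<eta> *\<^sub>R u) =
      (1 / (1 + s)) *\<^sub>R ((1 + s) *\<^sub>R (q + u))"
    unfolding divide_inverse scaleR_add_right x_def
    by (simp add: algebra_simps)
  also have "\<dots> = q + u" using s by simp
  finally show False using u by simp
qed

text \<open>Induction on \<open>n\<close> with \<open>V\<close> varying: take a closest frontier
  point \<open>q + u0\<close> in \<open>q + V\<close> and continue in the Hermitian complement of
  \<open>u0\<close> in \<open>V\<close>, which loses at most one dimension. All later vectors lie in
  that complement, which gives orthogonality and, through the tangent plane, disjointness from
  \<Omega>.\<close>

lemma orthogonal_frontier_system: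
  assumes \<Omega>: "C_properly_convex_domain \<Omega>" "q \<in> \<Omega>"
    and "vec.subspace V" "n \<le> vec.dim V"
  shows "\<exists>u :: nat \<Rightarrow> complex ^ 'd::finite. \<forall>j<n. u j \<in> V \<and> u j \<noteq> 0 \<and> q + u j \<in> frontier \<Omega> \<and>
    (\<forall>c. cmod c < 1 \<longrightarrow> q + c *s u j \<in> \<Omega>) \<and>
    (\<forall>k. j < k \<and> k < n \<longrightarrow> hermitian (u k) (u j) = 0) \<and>
    (\<forall>w \<in> vec.span {u k | k. j < k \<and> k < n}. q + u j + w \<notin> \<Omega>)"
  using assms(3,4)
proof (induction n arbitrary: V)
  case 0
  then show ?case by simp
next
  case (Suc n)
  have "\<not> V \<subseteq> {0}"
    using Suc.prems(2) vec.dim_eq_0[of V] by linarith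
  then obtain v where "v \<in> V" "v \<noteq> 0" by blast
  then obtain u0 where u0: "u0 \<in> V" "u0 \<noteq> 0" "q + u0 \<in> frontier \<Omega>"
    and ball: "\<And>w. w \<in> V \<Longrightarrow> norm w < norm u0 \<Longrightarrow> q + w \<in> \<Omega>"
    using closest_frontier_point_in_subspace[OF \<Omega> Suc.prems(1)] by blast
  define W where "W = {w \<in> V. hermitian w u0 = 0}"
  have W: "vec.subspace W"
    unfolding W_def using Suc.prems by (intro subspace_hermitian_complement)
  have "n \<le> vec.dim W"
    using dim_hermitian_complement[OF Suc.prems(1) u0(1,2)] Suc.prems(2) by (simp add: W_def)
  from Suc.IH[OF W this] obtain u where
    u: "\<And>j. j < n \<Longrightarrow> u j \<in> W \<and> u j \<noteq> 0 \<and> q + u j \<in> frontier \<Omega> \<and>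
      (\<forall>c. cmod c < 1 \<longrightarrow> q + c *s u j \<in> \<Omega>) \<and>
      (\<forall>k. j < k \<and> k < n \<longrightarrow> hermitian (u k) (u j) = 0) \<and>
      (\<forall>w \<in> vec.span {u k | k. j < k \<and> k < n}. q + u j + w \<notin> \<Omega>)"
    by blast
  \<comment> \<open>\<open>u0\<close> is put in front of the sequence found in \<open>W\<close>, so
    the later vectors move up by one index.\<close>
  define u' where "u' = case_nat u0 u"
  have shift: "{u' k | k. Suc j < k \<and> k < Suc n} = {u k | k. j < k \<and> k < n}" for j
  proof -
    have "{u' k | k. Suc j < k \<and> k < Suc n} = u' ` Suc ` {k. j < k \<and> k < n}"
      using Suc_less_eq2 by (auto simp: image_iff)
    also have "\<dots> = u ` {k. j < k \<and> k < n}"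
      by (simp add: u'_def image_image)
    finally show ?thesis by blast
  qed
  have shift0: "{u' k | k. 0 < k \<and> k < Suc n} \<subseteq> W"
    using u by (auto simp: u'_def gr0_conv_Suc)
  have conv: "convex \<Omega>" "open \<Omega>" using \<Omega> by (auto simp: C_properly_convex_domain_def)
  have u0_notin: "q + u0 \<notin> \<Omega>"
    using u0 conv by (simp add: frontier_def interior_open)
  have "\<forall>c. cmod c < 1 \<longrightarrow> q + c *s u0 \<in> \<Omega>"
    using ball Suc.prems(1) u0 by (simp add: norm_vector_scalar_mult vec.subspace_scale)
  moreover have "\<forall>k. 0 < k \<and> k < Suc n \<longrightarrow> hermitian (u' k) u0 = 0"
    using shift0 by (auto simp: W_def)
  moreover have "q + u0 + w \<notin> \<Omega>" if "w \<in> vec.span {u' k | k. 0 < k \<and> k < Suc n}" for w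
  proof -
    \<comment> \<open>The span stays in the complex subspace \<open>W\<close>; there the Hermitian
      product with \<open>u0\<close> vanishes, hence also its real part, as the tangent plane lemma
      requires.\<close>
    have "w \<in> W" using that shift0 W vec.span_minimal by blast
    then show ?thesis
      using conv u0 u0_notin ball Suc.prems(1)
      by (intro tangent_plane_disjoint[where V = V])
        (auto simp: W_def inner_eq_Re_hermitian vec_subspace_imp_subspace)
  qed
  ultimately have base: "u' 0 \<in> V \<and> u' 0 \<noteq> 0 \<and> q + u' 0 \<in> frontier \<Omega> \<and>
    (\<forall>c. cmod c < 1 \<longrightarrow> q + c *s u' 0 \<in> \<Omega>) \<and>
    (\<forall>k. 0 < k \<and> k < Suc n \<longrightarrow> hermitian (u' k) (u' 0) = 0) \<and>
    (\<forall>w \<in> vec.span {u' k | k. 0 < k \<and> k < Suc n}. q + u' 0 + w \<notin> \<Omega>)"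
    using u0 by (simp add: u'_def)
  have step: "u' (Suc j) \<in> V \<and> u' (Suc j) \<noteq> 0 \<and> q + u' (Suc j) \<in> frontier \<Omega> \<and>
    (\<forall>c. cmod c < 1 \<longrightarrow> q + c *s u' (Suc j) \<in> \<Omega>) \<and>
    (\<forall>k. Suc j < k \<and> k < Suc n \<longrightarrow> hermitian (u' k) (u' (Suc j)) = 0) \<and>
    (\<forall>w \<in> vec.span {u' k | k. Suc j < k \<and> k < Suc n}. q + u' (Suc j) + w \<notin> \<Omega>)"
    if "j < n" for j
    unfolding shift using u[OF that]
    by (auto simp: u'_def W_def split: nat.split)
  show ?case
  proof (intro exI[of _ u'] allI impI, goal_cases)
    case (1 j)
    show ?case
    proof (cases j)
      case 0
      show ?thesis unfolding 0 by (rule base)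
    next
      case (Suc i)
      show ?thesis unfolding Suc using 1 Suc by (intro step) simp
    qed
  qed
qed

lemma span_std_basis:
  "vec.span {std_basis k | k. P k} = {w :: complex ^ 'd::finite. \<forall>i. \<not> P i \<longrightarrow> w $ i = 0}"
proof (intro equalityI subsetI)
  fix w :: "complex ^ 'd" assume "w \<in> vec.span {std_basis k | k. P k}"
  moreover have "vec.subspace {w :: complex ^ 'd. \<forall>i. \<not> P i \<longrightarrow> w $ i = 0}"
    by (auto simp: vec.subspace_def)
  moreover have "{std_basis k | k. P k} \<subseteq> {w :: complex ^ 'd. \<forall>i. \<not> P i \<longrightarrow> w $ i = 0}"
    by (auto simp: std_basis_def axis_def)
  ultimately show "w \<in> {w. \<forall>i. \<not> P i \<longrightarrow> w $ i = 0}"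
    using vec.span_minimal by blast
next
  fix w :: "complex ^ 'd" assume w: "w \<in> {w. \<forall>i. \<not> P i \<longrightarrow> w $ i = 0}"
  have "w = (\<Sum>i\<in>UNIV. w $ i *s std_basis i)"
    by (simp add: std_basis_def basis_expansion)
  also have "\<dots> \<in> vec.span {std_basis k | k. P k}"
  proof (intro vec.span_sum)
    fix i :: 'd
    show "w $ i *s std_basis i \<in> vec.span {std_basis k | k. P k}"
      using w by (cases "P i") (auto intro: vec.span_scale vec.span_base vec.span_zero)
  qed
  finally show "w \<in> vec.span {std_basis k | k. P k}" .
qed

text \<open>The sequence indexed by \<open>nat\<close> is transported to the index type
  \<open>'d\<close> along the order. The slot of \<open>first_index\<close> holds an arbitrary
  \<open>p\<close>, later \<open>\<xi> - q\<close>; the \<open>dim V\<close> other indices receive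
  the orthogonal vectors.\<close>

lemma orthogonal_frontier_frame:
  fixes \<Omega> :: "(complex ^ 'd::{finite,linorder}) set"
  assumes \<Omega>: "C_properly_convex_domain \<Omega>" "q \<in> \<Omega>"
    and V: "vec.subspace V" "vec.dim V + 1 = CARD('d)"
  obtains f :: "'d \<Rightarrow> complex ^ 'd::{finite,linorder}" where "f first_index = p"
    "\<And>j. j \<noteq> first_index \<Longrightarrow> f j \<in> V \<and> f j \<noteq> 0 \<and> q + f j \<in> frontier \<Omega>"
    "\<And>j c. j \<noteq> first_index \<Longrightarrow> cmod c < 1 \<Longrightarrow> q + c *s f j \<in> \<Omega>"
    "\<And>j k. j \<noteq> first_index \<Longrightarrow> j < k \<Longrightarrow> hermitian (f k) (f j) = 0"
    "\<And>j w. j \<noteq> first_index \<Longrightarrow> w \<in> vec.span {f k | k. j < k} \<Longrightarrow> q + f j + w \<notin> \<Omega>"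
proof -
  define n where "n = vec.dim V"
  obtain u where u: "\<And>j. j < n \<Longrightarrow> u j \<in> V \<and> u j \<noteq> 0 \<and> q + u j \<in> frontier \<Omega> \<and>
      (\<forall>c. cmod c < 1 \<longrightarrow> q + c *s u j \<in> \<Omega>) \<and>
      (\<forall>k. j < k \<and> k < n \<longrightarrow> hermitian (u k) (u j) = 0) \<and>
      (\<forall>w \<in> vec.span {u k | k. j < k \<and> k < n}. q + u j + w \<notin> \<Omega>)"
    using orthogonal_frontier_system[OF \<Omega> V(1), of n] by (auto simp: n_def)
  \<comment> \<open>One is subtracted because \<open>first_index\<close> is itself a predecessor of
    every other index, so the second index gets position 0. Truncation could matter only at
    \<open>first_index\<close>, where \<open>f\<close> does not use \<open>m\<close>.\<close>
  define m where "m j = card {k. k < j} - 1" for j :: 'd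
  define f where "f j = (if j = first_index then p else u (m j))" for j
  have first_le: "first_index \<le> k" for k :: 'd
    by (simp add: first_index_def)
  have card_less: "card {i. i < j} < card {i. i < k}" if "j < k" for j k :: 'd
    using that by (intro psubset_card_mono) (auto simp: psubset_eq)
  have card_pos: "0 < card {i. i < j}" if "j \<noteq> first_index" for j :: 'd
    using that first_le[of j] by (auto simp: card_gt_0_iff intro!: exI[of _ first_index])
  have card_bound: "card {i. i < j} < CARD('d)" for j :: 'd
    by (intro psubset_card_mono) auto
  have m_bound: "m j < n" if "j \<noteq> first_index" for j
    using card_pos[OF that] card_bound[of j] V(2) by (simp add: m_def n_def)
  have m_less: "m j < m k" if "j \<noteq> first_index" "j < k" for j k
    using card_pos[OF that(1)] card_less[OF that(2)] by (simp add: m_def)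
  have above: "k \<noteq> first_index" if "j < k" for j k :: 'd
    using that first_le[of j] by auto
  \<comment> \<open>Since \<open>m\<close> preserves the order, the later vectors of
    \<open>f\<close> are among the later vectors of \<open>u\<close>; disjointness from \<Omega>
    passes to the span.\<close>
  have sub: "{f k | k. j < k} \<subseteq> {u k | k. m j < k \<and> k < n}" if "j \<noteq> first_index" for j
    using m_less[OF that] m_bound above by (fastforce simp: f_def)
  show thesis
  proof (rule that[of f])
    show "f first_index = p" by (simp add: f_def)
  next
    fix j :: 'd assume j: "j \<noteq> first_index"
    note uj = u[OF m_bound[OF j]]
    have fj: "f j = u (m j)" using j by (simp add: f_def)
    show "f j \<in> V \<and> f j \<noteq> 0 \<and> q + f j \<in> frontier \<Omega>"
      using uj by (simp add: fj)
    show "q + c *s f j \<in> \<Omega>" if "cmod c < 1" for c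
      using uj that by (simp add: fj)
    show "hermitian (f k) (f j) = 0" if "j < k" for k
      using uj m_less[OF j that] m_bound[OF above[OF that]] above[OF that]
      by (simp add: fj) (simp add: f_def)
    show "q + f j + w \<notin> \<Omega>" if "w \<in> vec.span {f k | k. j < k}" for w
      using uj that vec.span_mono[OF sub[OF j]] by (auto simp: fj)
  qed
qed

section \<open>Balls in \<Omega> around points of a segment to the boundary\<close>

lemma mem_of_dist_lt_bdry_dist:
  assumes "z \<in> \<Omega>" "dist z y < bdry_dist \<Omega> z"
  shows "y \<in> \<Omega>"
proof (rule ccontr)
  assume "y \<notin> \<Omega>"
  then obtain t where t: "0 \<le> t" "t \<le> 1" "z + t *\<^sub>R (y - z) \<in> frontier \<Omega>"
    using frontier_meets_segment[OF assms(1)] by blast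
  then have "bdry_dist \<Omega> z \<le> dist z (z + t *\<^sub>R (y - z))"
    unfolding bdry_dist_def by (intro infdist_le)
  also have "\<dots> = t * dist z y"
    using t by (simp add: dist_norm norm_minus_commute)
  also have "\<dots> \<le> dist z y"
    using t by (intro mult_left_le_one_le) auto
  finally show False using assms(2) by simp
qed

text \<open>The homothety with centre \<xi> and ratio
  \<open>norm (\<xi> - q) / norm (\<xi> - z)\<close> takes \<open>z\<close> to \<open>q\<close>, and
  by convexity it takes \<Omega> into itself. It carries the ball of radius
  \<open>bdry_dist \<Omega> z\<close> about \<open>z\<close> to the given ball.\<close>

lemma ball_subset_along_segment:
  assumes \<Omega>: "convex \<Omega>" "open \<Omega>" "z \<in> \<Omega>" and \<xi>: "\<xi> \<in> frontier \<Omega>"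
    and q: "q \<in> closed_segment \<xi> z - {\<xi>}"
  shows "ball q (bdry_dist \<Omega> z / norm (\<xi> - z) * norm (\<xi> - q)) \<subseteq> \<Omega>"
proof
  fix y assume y: "y \<in> ball q (bdry_dist \<Omega> z / norm (\<xi> - z) * norm (\<xi> - q))"
  obtain t where t: "0 \<le> t" "t \<le> 1" "q = (1 - t) *\<^sub>R \<xi> + t *\<^sub>R z"
    using q by (auto simp: in_segment)
  then have "t \<noteq> 0" using q by auto
  then have t0: "0 < t" using t by simp
  have "\<xi> \<noteq> z" using \<Omega> \<xi> by (auto simp: frontier_def interior_open)
  have eq: "\<xi> - q = t *\<^sub>R (\<xi> - z)" by (simp add: t algebra_simps)
  have "norm (\<xi> - q) = t * norm (\<xi> - z)" unfolding eq using t0 by simp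
  then have d: "dist q y < t * bdry_dist \<Omega> z"
    using y \<open>\<xi> \<noteq> z\<close> by (simp add: mult.commute)
  \<comment> \<open>\<open>z'\<close> is the preimage of \<open>y\<close> under the homothety with
    centre \<xi> and ratio \<open>t\<close>.\<close>
  define z' where "z' = z + (1 / t) *\<^sub>R (y - q)"
  have "dist z z' = dist q y / t"
    using t0 by (simp add: z'_def dist_norm norm_minus_commute)
  also have "\<dots> < bdry_dist \<Omega> z"
    using d t0 by (simp add: field_simps)
  finally have "z' \<in> interior \<Omega>"
    using mem_of_dist_lt_bdry_dist[OF \<Omega>(3)] \<Omega>(2) by (simp add: interior_open)
  then have "\<xi> - t *\<^sub>R (\<xi> - z') \<in> interior \<Omega>"
    using \<Omega> \<xi> t0 t by (intro mem_interior_closure_convex_shrink) (auto simp: frontier_def)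
  moreover have "\<xi> - t *\<^sub>R (\<xi> - z') = y"
    using t0 by (simp add: z'_def t algebra_simps)
  ultimately show "y \<in> \<Omega>" using interior_subset by auto
qed

theorem theorem4p3:
  fixes \<Omega> H :: "(complex ^ 'd::{finite,linorder}) set"
    and z\<^sub>0 \<xi> q :: "complex ^ 'd::{finite,linorder}"
    and r :: real
  assumes "C_properly_convex_domain \<Omega>"
    and "z\<^sub>0 \<in> \<Omega>"
    and "\<xi> \<in> frontier \<Omega>"
    and "supporting_complex_hyperplane \<Omega> \<xi> H"
    and "q \<in> closed_segment \<xi> z\<^sub>0 - {\<xi>}"
    and "r = bdry_dist \<Omega> z\<^sub>0 / norm (\<xi> - z\<^sub>0)"
  shows "\<exists>A. affine_automorphism A \<and>
    A ` \<Omega> \<in> K_class r \<and>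
    A q = 0 \<and>
    A \<xi> = std_basis first_index \<and>
    A ` H = (+) (std_basis first_index) ` vec.span {std_basis k | k. first_index < k} \<and>
    (let S = {bdry_dist_dir \<Omega> q v | v. v \<in> (+) (- \<xi>) ` H \<and> v \<noteq> 0} in
      (S \<noteq> {} \<longrightarrow> (\<exists>\<delta>\<^sub>H. is_maximum S \<delta>\<^sub>H)) \<and>
      (\<forall>\<delta>\<^sub>H. is_maximum S \<delta>\<^sub>H \<longrightarrow>
        (\<forall>z\<^sub>1 z\<^sub>2. norm (A z\<^sub>1 - A z\<^sub>2) \<ge> r / (sqrt 2 * \<delta>\<^sub>H) * norm (z\<^sub>1 - z\<^sub>2))))"
proof -

  \<comment> \<open>Bounds on \<open>r\<close> and the ball around \<open>q\<close>\<close>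
  have conv: "convex \<Omega>" "open \<Omega>"
    using assms(1) by (auto simp: C_properly_convex_domain_def)
  have \<xi>: "\<xi> \<in> closure \<Omega>" "\<xi> \<notin> \<Omega>"
    using assms(3) conv by (auto simp: frontier_def interior_open)
  have "\<xi> \<noteq> z\<^sub>0" using \<xi> assms(2) by auto
  have z\<^sub>0: "z\<^sub>0 \<notin> frontier \<Omega>"
    using assms(2) conv by (simp add: frontier_def interior_open)
  have "0 < bdry_dist \<Omega> z\<^sub>0"
    unfolding bdry_dist_def using assms(3) z\<^sub>0 by (intro infdist_pos_not_in_closed) auto
  then have r0: "0 < r" using \<open>\<xi> \<noteq> z\<^sub>0\<close> by (simp add: assms(6))
  have "bdry_dist \<Omega> z\<^sub>0 \<le> norm (\<xi> - z\<^sub>0)"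
    unfolding bdry_dist_def using infdist_le[OF assms(3), of z\<^sub>0]
    by (simp add: dist_norm norm_minus_commute)
  then have r1: "r \<le> 1" by (simp add: assms(6) divide_le_eq_1)
  have ball_q: "ball q (r * norm (\<xi> - q)) \<subseteq> \<Omega>"
    unfolding assms(6) by (intro ball_subset_along_segment conv assms)
  have "\<xi> \<noteq> q" using assms(5) by auto
  then have q: "q \<in> \<Omega>" using r0 ball_q by (auto intro!: subsetD[OF ball_q])

  \<comment> \<open>The direction space of \<open>H\<close>\<close>
  define V where "V = (+) (- \<xi>) ` H"
  obtain p V\<^sub>0 where V\<^sub>0: "vec.subspace V\<^sub>0" "vec.dim V\<^sub>0 + 1 = CARD('d)" "H = (+) p ` V\<^sub>0"
    and H: "\<xi> \<in> H" "H \<inter> \<Omega> = {}"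
    using assms(4) unfolding supporting_complex_hyperplane_def complex_hyperplane_def by blast
  obtain v\<^sub>0 where v\<^sub>0: "\<xi> = p + v\<^sub>0" "v\<^sub>0 \<in> V\<^sub>0" using H V\<^sub>0(3) by blast
  have H_iff: "z \<in> H \<longleftrightarrow> z - \<xi> \<in> V" for z
    unfolding V_def by (auto simp: image_iff algebra_simps)
  \<comment> \<open>Moving the base point of \<open>H\<close> from \<open>p\<close> to \<xi> leaves
    the direction space unchanged.\<close>
  have "v \<in> V \<longleftrightarrow> v \<in> V\<^sub>0" for v
  proof -
    have "v \<in> V \<longleftrightarrow> v + \<xi> \<in> H" by (simp add: H_iff)
    also have "\<dots> \<longleftrightarrow> v + v\<^sub>0 \<in> V\<^sub>0"
      unfolding V\<^sub>0(3) v\<^sub>0(1) by (auto simp: image_iff algebra_simps)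
    also have "\<dots> \<longleftrightarrow> v \<in> V\<^sub>0"
      using vec.subspace_add[OF V\<^sub>0(1) _ v\<^sub>0(2)] vec.subspace_diff[OF V\<^sub>0(1) _ v\<^sub>0(2)]
      by (metis add_diff_cancel_right')
    finally show ?thesis .
  qed
  then have V: "vec.subspace V" "vec.dim V + 1 = CARD('d)"
    using V\<^sub>0 by (simp_all add: set_eqI[of V V\<^sub>0])
  have "\<xi> - q \<notin> V"
  proof
    assume "\<xi> - q \<in> V"
    then have "- 1 *s (\<xi> - q) \<in> V" by (rule vec.subspace_scale[OF V(1)])
    then have "q \<in> H" by (simp add: H_iff)
    then show False using H q by blast
  qed

  \<comment> \<open>The frame and the linear map \<open>B\<close> with columns
    \<open>f j\<close>\<close>
  obtain f :: "'d \<Rightarrow> complex ^ 'd::{finite,linorder}" where f0: "f first_index = \<xi> - q"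
    and fV: "\<And>j. j \<noteq> first_index \<Longrightarrow> f j \<in> V \<and> f j \<noteq> 0 \<and> q + f j \<in> frontier \<Omega>"
    and disc: "\<And>j c. j \<noteq> first_index \<Longrightarrow> cmod c < 1 \<Longrightarrow> q + c *s f j \<in> \<Omega>"
    and herm: "\<And>j k. j \<noteq> first_index \<Longrightarrow> j < k \<Longrightarrow> hermitian (f k) (f j) = 0"
    and supp: "\<And>j w. j \<noteq> first_index \<Longrightarrow> w \<in> vec.span {f k | k. j < k} \<Longrightarrow> q + f j + w \<notin> \<Omega>"
    by (fact orthogonal_frontier_frame[OF assms(1) q V])
  have first_less: "first_index < k \<longleftrightarrow> k \<noteq> first_index" for k :: 'd
    by (auto simp: first_index_def order_less_le)
  define M where "M = (\<chi> i j. f j $ i)"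
  define B where "B = (*v) M"
  \<comment> \<open>\<open>T\<close> collects the part of \<open>B\<close> with values in
    \<open>V\<close>, separating it from the direction \<open>\<xi> - q\<close>.\<close>
  define T where "T w = (\<Sum>j\<in>UNIV - {first_index}. w $ j *s f j)" for w
  have B_sum: "B w = (\<Sum>j\<in>UNIV. w $ j *s f j)" for w
    by (simp add: B_def M_def matrix_mult_sum column_def)
  have B_split: "B w = w $ first_index *s (\<xi> - q) + T w" for w
    unfolding B_sum T_def by (subst sum.remove[of _ first_index]) (auto simp: f0)
  have B_lin: "Vector_Spaces.linear (*s) (*s) B"
    by (simp add: B_def)
  have B_basis: "B (std_basis j) = f j" for j
  proof -
    have "(\<Sum>i\<in>UNIV. std_basis j $ i *s f i) = (\<Sum>i\<in>UNIV. if i = j then f i else 0)"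
      by (intro sum.cong) (auto simp: std_basis_def axis_def)
    then show ?thesis by (simp add: B_sum)
  qed
  have T_V: "T w \<in> V" for w
    unfolding T_def using fV by (intro vec.subspace_sum vec.subspace_scale V) auto
  \<comment> \<open>As \<open>\<xi> - q\<close> is transversal to \<open>V\<close>, the first
    coordinate alone decides membership. Conditions on \<open>H\<close> thus become conditions on
    one coordinate.\<close>
  have B_V: "B w \<in> V \<longleftrightarrow> w $ first_index = 0" for w
  proof
    assume "B w \<in> V"
    then have "B w - T w \<in> V" using T_V V(1) vec.subspace_diff by blast
    then have a: "w $ first_index *s (\<xi> - q) \<in> V" by (simp add: B_split)
    show "w $ first_index = 0"
    proof (rule ccontr)
      assume "w $ first_index \<noteq> 0"
      then have "\<xi> - q = inverse (w $ first_index) *s (w $ first_index *s (\<xi> - q))"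
        by (simp add: vector_smult_assoc)
      then show False using a V(1) \<open>\<xi> - q \<notin> V\<close> vec.subspace_scale by metis
    qed
  qed (simp add: B_split T_V)
  \<comment> \<open>\<open>herm\<close> covers one order of the indices and conjugate symmetry the
    other. The summands of \<open>T w\<close> are then also orthogonal over the reals, and
    Pythagoras applies.\<close>
  have norm_T: "(norm (T w))\<^sup>2 = (\<Sum>j\<in>UNIV - {first_index}. (cmod (w $ j) * norm (f j))\<^sup>2)" for w
  proof -
    have "hermitian (f i) (f j) = 0" if "i \<noteq> first_index" "j \<noteq> first_index" "i \<noteq> j" for i j
      using that herm[of i j] herm[of j i] hermitian_commute[of "f i" "f j"]
      by (cases i j rule: linorder_cases) auto
    then have "pairwise (\<lambda>i j. orthogonal (w $ i *s f i) (w $ j *s f j)) (UNIV - {first_index})"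
      by (auto simp: pairwise_def orthogonal_def inner_eq_Re_hermitian
          hermitian_scale_left hermitian_scale_right)
    then show ?thesis
      unfolding T_def by (subst norm_sum_Pythagorean) (auto simp: norm_vector_scalar_mult)
  qed
  have "w = 0" if "B w = 0" for w
  proof -
    have w0: "w $ first_index = 0"
      using B_V[of w] that V(1) by (simp add: vec.subspace_0)
    then have "T w = 0" using that by (simp add: B_split)
    then have "(\<Sum>j\<in>UNIV - {first_index}. (cmod (w $ j) * norm (f j))\<^sup>2) = 0"
      using norm_T[of w] by simp
    then have "w $ j = 0" if "j \<noteq> first_index" for j
      using that fV[OF that] by (subst (asm) sum_nonneg_eq_0_iff) auto
    then show ?thesis using w0 by (metis vec_eq_iff zero_index)
  qed
  then have "inj B" using vec.linear_inj_iff_eq_0[OF B_lin] by blast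
  then have "surj B" using vec.linear_inj_imp_surj[OF B_lin] by blast
  define L where "L = inv B"
  have BL: "B (L z) = z" and LB: "L (B w) = w" for z w
    using \<open>inj B\<close> \<open>surj B\<close> by (simp_all add: L_def surj_f_inv_f)
  have L_lin: "Vector_Spaces.linear (*s) (*s) L"
    unfolding L_def using B_lin \<open>inj B\<close> by (rule vec.inj_linear_imp_inv_linear)
  have "bij L" using BL LB by (intro o_bij[of B]) (auto simp: fun_eq_iff)

  \<comment> \<open>The affine map \<open>A\<close>, inverse to \<open>w \<mapsto> q + B w\<close>,
    and the class \<open>K_class r\<close>\<close>
  define A where "A z = L (z - q)" for z
  have A_iff: "A z = w \<longleftrightarrow> z = q + B w" for z w
    using BL[of "z - q"] by (auto simp: A_def LB)
  have A_aut: "affine_automorphism A"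
    unfolding affine_automorphism_def
    using L_lin \<open>bij L\<close>
    by (intro exI[of _ L] exI[of _ "- L q"]) (simp add: A_def fun_eq_iff vec.linear_diff)
  have B_add: "B (x + y) = B x + B y" and B_scale: "B (c *s x) = c *s B x" for x y c
    using B_lin by (simp_all add: vec.linear_add vec.linear_scale)
  have mem: "w \<in> A ` X \<longleftrightarrow> q + B w \<in> X" for w X
    unfolding image_iff using A_iff by metis
  \<comment> \<open>As a preimage under the linear map \<open>B\<close>, the image of \<Omega>
    inherits openness and convexity.\<close>
  have A_vimage: "A ` \<Omega> = B -` ((+) (- q) ` \<Omega>)"
  proof (intro set_eqI)
    fix w
    have "B w \<in> (+) (- q) ` \<Omega> \<longleftrightarrow> q + B w \<in> \<Omega>"
      by (auto simp: image_iff intro!: bexI[of _ "q + B w"])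
    then show "w \<in> A ` \<Omega> \<longleftrightarrow> w \<in> B -` ((+) (- q) ` \<Omega>)" by (simp only: mem vimage_eq)
  qed
  have A_open: "open (A ` \<Omega>)"
  proof -
    have "continuous_on UNIV B"
      by (auto simp: B_def matrix_vector_mult_def intro!: continuous_intros)
    then show ?thesis
      unfolding A_vimage using conv(2) by (intro open_vimage open_translation)
  qed
  have A_convex: "convex (A ` \<Omega>)"
  proof -
    have "linear B"
      by (intro linearI) (simp_all add: B_add B_scale scaleR_eq_vector_scalar_mult)
    then show ?thesis
      unfolding A_vimage using conv(1) by (intro convex_linear_vimage convex_translation)
  qed
  have A_domain: "C_properly_convex_domain (A ` \<Omega>)"
  proof -
    have False if "v \<noteq> 0" "range (\<lambda>c. z + c *s v) \<subseteq> A ` \<Omega>" for z v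
    proof -
      have "q + B (z + c *s v) \<in> \<Omega>" for c using that(2) mem by blast
      then have "range (\<lambda>c. (q + B z) + c *s B v) \<subseteq> \<Omega>"
        by (auto simp: B_add B_scale add.assoc)
      moreover have "B v \<noteq> 0" using \<open>\<And>w. B w = 0 \<Longrightarrow> w = 0\<close> that(1) by blast
      ultimately show False using assms(1) by (auto simp: C_properly_convex_domain_def)
    qed
    then show ?thesis
      unfolding C_properly_convex_domain_def
      using A_open A_convex convex_connected q by blast
  qed
  \<comment> \<open>The ball around \<open>q\<close> has radius \<open>r * norm (\<xi> - q)\<close>,
    so its disc in the direction \<open>\<xi> - q\<close> has radius \<open>r\<close> in the first
    coordinate.\<close>
  have disc0: "q + c *s (\<xi> - q) \<in> \<Omega>" if "cmod c < r" for c
  proof -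
    have "norm (c *s (\<xi> - q)) < r * norm (\<xi> - q)"
      unfolding norm_vector_scalar_mult using that \<open>\<xi> \<noteq> q\<close> by simp
    then show ?thesis
      by (intro subsetD[OF ball_q]) (simp add: dist_norm del: vector_ssub_ldistrib)
  qed
  have frontier_A: "std_basis j \<in> frontier (A ` \<Omega>)" for j
  proof -
    have "q + f j \<notin> \<Omega>"
      using fV[of j] conv \<xi> f0 by (cases "j = first_index") (auto simp: frontier_def interior_open)
    then have "std_basis j \<notin> interior (A ` \<Omega>)"
      using A_open by (simp add: interior_open mem B_basis)
    moreover have "std_basis j \<in> closure (A ` \<Omega>)"
    proof -
      \<comment> \<open>The open segment towards \<open>std_basis j\<close> lies in the image, so
        \<open>std_basis j\<close> is a limit of points of the image.\<close>
      have inside: "t *\<^sub>R std_basis j \<in> A ` \<Omega>" if t: "0 \<le> t" "t < 1" for t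
      proof -
        have "q + f j \<in> closure \<Omega>"
          using fV[of j] \<xi> f0 by (cases "j = first_index") (auto simp: frontier_def)
        then have "q + t *\<^sub>R ((q + f j) - q) \<in> \<Omega>"
          using conv q t by (intro open_convex_segment_mem)
        then show ?thesis
          by (simp add: mem scaleR_eq_vector_scalar_mult B_scale B_basis)
      qed
      have "(\<lambda>n. (1 - 1 / real (Suc n)) *\<^sub>R std_basis j) \<longlonglongrightarrow>
          (1 - 0) *\<^sub>R (std_basis j :: complex ^ 'd::{finite,linorder})"
        by (intro tendsto_intros LIMSEQ_Suc[OF lim_1_over_n])
      moreover have "(1 - 1 / real (Suc n)) *\<^sub>R std_basis j \<in> A ` \<Omega>" for n
        by (intro inside) (auto simp: field_simps)
      ultimately show ?thesis
        unfolding closure_sequential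
        by (intro exI[of _ "\<lambda>n. (1 - 1 / real (Suc n)) *\<^sub>R std_basis j"]) simp
    qed
    ultimately show ?thesis by (simp add: frontier_def)
  qed
  \<comment> \<open>For the first index the plane corresponds to \<open>H\<close>; for the others it
    lies over the tangent plane at \<open>q + f j\<close>.\<close>
  have supp_A: "(+) (std_basis j) ` vec.span {std_basis k | k. j < k} \<inter> A ` \<Omega> = {}" for j
  proof -
    have "q + f j + B w \<notin> \<Omega>" if w: "w \<in> vec.span {std_basis k | k. j < k}" for w
    proof (cases "j = first_index")
      case True
      then have "B w \<in> V"
        using w by (simp add: span_std_basis B_V)
      then have "\<xi> + B w \<in> H" by (simp add: H_iff)
      then show ?thesis using True H f0 by auto
    next
      case False
      have "w $ k = 0" if "\<not> j < k" for k
        using that w by (simp add: span_std_basis)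
      then have "w $ k *s f k \<in> vec.span {f k | k. j < k}" for k
        by (cases "j < k") (auto intro: vec.span_scale vec.span_base vec.span_zero)
      then have "B w \<in> vec.span {f k | k. j < k}"
        unfolding B_sum by (intro vec.span_sum)
      then show ?thesis using supp[OF False] by blast
    qed
    then have "std_basis j + w \<notin> A ` \<Omega>" if "w \<in> vec.span {std_basis k | k. j < k}" for w
      using that by (simp add: mem B_add B_basis add.assoc)
    then show ?thesis by blast
  qed
  have K: "A ` \<Omega> \<in> K_class r"
  proof -
    have "c *s std_basis first_index \<in> A ` \<Omega>" if "cmod c < r" for c
      unfolding mem B_scale B_basis f0 using disc0[OF that] .
    moreover have "c *s std_basis j \<in> A ` \<Omega>" if "j \<noteq> first_index" "cmod c < 1" for c j
      unfolding mem B_scale B_basis using disc[OF that] .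
    ultimately show ?thesis
      unfolding K_class_def using r0 r1 A_domain frontier_A supp_A by auto
  qed
  have A_H: "A ` H = (+) (std_basis first_index) ` vec.span {std_basis k | k. first_index < k}"
  proof (intro set_eqI)
    fix w
    have "w \<in> A ` H \<longleftrightarrow> q + B w \<in> H" by (rule mem)
    also have "\<dots> \<longleftrightarrow> B (w - std_basis first_index) \<in> V"
      by (simp add: H_iff vec.linear_diff[OF B_lin] B_basis f0 algebra_simps)
    also have "\<dots> \<longleftrightarrow> w - std_basis first_index \<in> vec.span {std_basis k | k. first_index < k}"
      by (simp add: B_V span_std_basis first_less)
    also have "\<dots> \<longleftrightarrow> w \<in> (+) (std_basis first_index) ` vec.span {std_basis k | k. first_index < k}"
      by (auto simp: image_iff algebra_simps intro!: bexI[of _ "w - std_basis first_index"])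
    finally show "w \<in> A ` H \<longleftrightarrow>
      w \<in> (+) (std_basis first_index) ` vec.span {std_basis k | k. first_index < k}" .
  qed

  \<comment> \<open>The lower bound on the expansion of \<open>A\<close>\<close>
  define S where "S = {bdry_dist_dir \<Omega> q v | v. v \<in> V \<and> v \<noteq> 0}"
  \<comment> \<open>\<open>S\<close> is empty exactly when \<open>V\<close> is trivial, that is, in
    dimension one.\<close>
  have S_max: "\<exists>\<delta>. is_maximum S \<delta>" if "S \<noteq> {}"
    using bdry_dist_dir_attains_max[OF assms(1) q V(1) S_def that] .
  have expand: "r / (sqrt 2 * \<delta>) * norm (z\<^sub>1 - z\<^sub>2) \<le> norm (A z\<^sub>1 - A z\<^sub>2)"
    if \<delta>: "is_maximum S \<delta>" for \<delta> z\<^sub>1 z\<^sub>2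
  proof -
    obtain v where v: "\<delta> = bdry_dist_dir \<Omega> q v" "v \<noteq> 0"
      using \<delta> unfolding is_maximum_def S_def by blast
    \<comment> \<open>The ball around \<open>q\<close> contains a disc of this radius in every
      complex direction, in particular along \<open>v\<close>.\<close>
    have "r * norm (\<xi> - q) \<le> bdry_dist_dir \<Omega> q v"
      by (intro bdry_dist_dir_ge[OF assms(1) q v(2)] subsetD[OF ball_q])
        (simp add: dist_norm norm_vector_scalar_mult)
    then have le0: "r * norm (\<xi> - q) \<le> \<delta>" by (simp add: v)
    moreover have "0 < r * norm (\<xi> - q)" using r0 \<open>\<xi> \<noteq> q\<close> by simp
    ultimately have \<delta>0: "0 < \<delta>" by linarith
    \<comment> \<open>The disc of radius \<open>norm (f j)\<close> along \<open>f j\<close> lies in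
      \<Omega>, so the directional distance, and with it the maximum, is at least that
      radius.\<close>
    have le: "norm (f j) \<le> \<delta>" if j: "j \<noteq> first_index" for j
    proof -
      have "norm (f j) \<le> bdry_dist_dir \<Omega> q (f j)"
        using assms(1) q fV[OF j] disc[OF j] by (intro bdry_dist_dir_ge) auto
      moreover have "bdry_dist_dir \<Omega> q (f j) \<in> S" using fV[OF j] by (auto simp: S_def)
      ultimately show ?thesis using \<delta> unfolding is_maximum_def by force
    qed
    define w where "w = A z\<^sub>1 - A z\<^sub>2"
    have Bw: "B w = z\<^sub>1 - z\<^sub>2"
      by (simp add: w_def A_def vec.linear_diff[OF B_lin] BL)
    \<comment> \<open>\<open>C\<close> bounds every column of \<open>B\<close>:
      \<open>\<xi> - q\<close> by the ball estimate, the others because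
      \<open>r \<le> 1\<close>.\<close>
    define C where "C = \<delta> / r"
    have C: "0 < C" "\<delta> \<le> C" "norm (\<xi> - q) \<le> C"
      using \<delta>0 r0 r1 le0 by (auto simp: C_def field_simps)
    let ?a = "cmod (w $ first_index) * norm (\<xi> - q)"
    have "norm (B w) \<le> ?a + norm (T w)"
      unfolding B_split by (metis norm_triangle_ineq norm_vector_scalar_mult)
    then have "(norm (B w))\<^sup>2 \<le> (?a + norm (T w))\<^sup>2" by (intro power_mono) auto
    \<comment> \<open>The direction \<open>\<xi> - q\<close> need not be orthogonal to
      \<open>V\<close>, so the squares are combined by \<open>(a + b)^2 \<le> 2 (a^2 + b^2)\<close>;
      this is the source of \<open>sqrt 2\<close>.\<close>
    also have "\<dots> \<le> 2 * (?a\<^sup>2 + (norm (T w))\<^sup>2)"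
      using sum_squares_bound[of ?a "norm (T w)"] by (simp add: power2_sum)
    also have "\<dots> \<le> 2 * ((cmod (w $ first_index) * C)\<^sup>2 +
        (\<Sum>j\<in>UNIV - {first_index}. (cmod (w $ j) * C)\<^sup>2))"
      unfolding norm_T using C le
      by (intro mult_left_mono add_mono sum_mono power_mono)
        (auto intro: order_trans[OF le])
    also have "\<dots> = 2 * (\<Sum>j\<in>UNIV. (cmod (w $ j) * C)\<^sup>2)"
      by (subst sum.remove[of UNIV first_index]) auto
    also have "\<dots> = (sqrt 2 * C * norm w)\<^sup>2"
      by (simp add: norm_vec_def L2_set_def power_mult_distrib sum_nonneg
          sum_distrib_right[symmetric])
    finally have "norm (B w) \<le> sqrt 2 * C * norm w"
      using C by (intro power2_le_imp_le[of "norm (B w)"]) auto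
    then have "norm (z\<^sub>1 - z\<^sub>2) \<le> sqrt 2 * \<delta> / r * norm w" by (simp add: Bw C_def)
    then have "r / (sqrt 2 * \<delta>) * norm (z\<^sub>1 - z\<^sub>2) \<le>
        r / (sqrt 2 * \<delta>) * (sqrt 2 * \<delta> / r * norm w)"
      using r0 \<delta>0 by (intro mult_left_mono) auto
    also have "\<dots> = norm w" using r0 \<delta>0 by simp
    finally show ?thesis by (simp add: w_def)
  qed
  have "A q = 0" by (simp add: A_iff B_split T_def)
  moreover have "A \<xi> = std_basis first_index" by (simp add: A_iff B_basis f0)
  ultimately show ?thesis
    using A_aut K A_H S_max expand unfolding Let_def V_def[symmetric] S_def[symmetric]
    by (intro exI[of _ A]) blast
qed

end
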